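(* Let $G$ be a connected graph and $uv$ an edge of $G$ with $d_u\geq 2$ and $d_v\geq 2$, and suppose $N_G(u)\cap N_G(v)=\emptyset$. Let $X=(x_w)_{w\in V(G)}$ be a unit eigenvector of the Sombor matrix $\mathcal{S}(G)$ corresponding to its largest eigenvalue $\rho_1(G)$. Let $$G^{*}=G-\{vw:w\in N_G(v)\setminus \{u\}\}+\{uw:w\in N_G(v)\setminus \{u\}\}.$$ If $x_u\geq x_v$, then $\rho_1(G^{*})>\rho_1(G)$.
   Context: Graphs are simple and undirected; $N_G(w)$ is the neighborhood of $w$ in $G$ and $d_w=|N_G(w)|$ its degree. The Sombor matrix $\mathcal{S}(G)$ has $(i,j)$-entry $\sqrt{d_i^2+d_j^2}$ if $v_i,v_j$ are adjacent and $0$ otherwise; $\rho_1(G)$ denotes its largest eigenvalue (computed with degrees in the respective graph, so $\rho_1(G^* )$ uses degrees in $G^*$). *)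

theory Defs
  imports "HOL-Analysis.Analysis" "Graph_Theory.Graph_Theory"
begin

text \<open>
  A finite simple undirected graph is a \<open>pair_graph\<close>, so an edge \<open>uv\<close> is the pair of arcs
  \<open>(u, v)\<close> and \<open>(v, u)\<close>.
\<close>

definition neighborhood :: "'a pair_pre_digraph \<Rightarrow> 'a \<Rightarrow> 'a set" where
  "neighborhood G w = {z. (w, z) \<in> parcs G}"

definition vertex_degree :: "'a pair_pre_digraph \<Rightarrow> 'a \<Rightarrow> nat" where
  "vertex_degree G w = card (neighborhood G w)"

definition edges_between :: "'a \<Rightarrow> 'a set \<Rightarrow> ('a \<times> 'a) set" where
  "edges_between a W = (\<Union>w\<in>W. {(a, w), (w, a)})"

definition shift_edges :: "'a pair_pre_digraph \<Rightarrow> 'a \<Rightarrow> 'a \<Rightarrow> 'a pair_pre_digraph" where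
  "shift_edges G u v =
     G\<lparr>parcs := (parcs G - edges_between v (neighborhood G v - {u}))
               \<union> edges_between u (neighborhood G v - {u})\<rparr>"

text \<open>
  Matrices are indexed by the vertex type itself. The Sombor matrix is therefore meaningful only
  for graphs whose vertex set is the whole (finite) type.
\<close>

definition sombor_matrix :: "'a::finite pair_pre_digraph \<Rightarrow> real^'a^'a" where
  "sombor_matrix G =
     (\<chi> i j. if (i, j) \<in> parcs G
             then sqrt ((real (vertex_degree G i))\<^sup>2 + (real (vertex_degree G j))\<^sup>2) else 0)"

definition real_eigenvector :: "real^'n^'n \<Rightarrow> real^'n \<Rightarrow> real \<Rightarrow> bool" where
  "real_eigenvector A x k \<longleftrightarrow> x \<noteq> 0 \<and> A *v x = k *\<^sub>R x"

definition real_eigenvalue :: "real^'n^'n \<Rightarrow> real \<Rightarrow> bool" where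
  "real_eigenvalue A k \<longleftrightarrow> (\<exists>x. real_eigenvector A x k)"

text \<open>
  The Sombor matrix of a graph is real symmetric, so its set of real eigenvalues is finite and
  nonempty, and \<open>Max\<close> is its largest element.
\<close>

definition sombor_rho1 :: "'a::finite pair_pre_digraph \<Rightarrow> real" where
  "sombor_rho1 G = Max {k. real_eigenvalue (sombor_matrix G) k}"

end

theory Submission
  imports Defs
begin

text \<open>
  Replacing the eigenvector by its entrywise absolute value \<open>Y\<close> preserves the Rayleigh quotient
  \<open>\<rho>\<^sub>1(G)\<close>, so \<open>Y\<close> is again an eigenvector, and it is positive because \<open>G\<close> is connected. Let \<open>Z\<close>
  agree with \<open>Y\<close> outside \<open>u\<close> and \<open>v\<close>, with \<open>Z\<^sub>u\<close> and \<open>Z\<^sub>v\<close> the larger and the smaller of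
  \<open>Y\<^sub>u\<close> and \<open>Y\<^sub>v\<close>. Since \<open>X\<close> may be negative, \<open>X\<^sub>u \<ge> X\<^sub>v\<close> does not say which
  is which; the exchange costs nothing because moving the edges from \<open>u\<close> to \<open>v\<close> instead gives an
  isomorphic graph. Send every edge other than \<open>uv\<close> to its image under
  the identification of \<open>v\<close> with \<open>u\<close>, and \<open>uv\<close> to itself. Along this injection from the edges of \<open>G\<close>
  to those of \<open>G\<^sup>*\<close> no term of the quadratic form decreases, and the term of \<open>uv\<close> increases
  strictly, because
  \<open>(d\<^sub>u + d\<^sub>v - 1)\<^sup>2 + 1 - d\<^sub>u\<^sup>2 - d\<^sub>v\<^sup>2 = 2 (d\<^sub>u - 1) (d\<^sub>v - 1) > 0\<close>.
  Hence \<open>Z\<close> has a larger Rayleigh quotient in \<open>G\<^sup>*\<close> than \<open>Y\<close> has in \<open>G\<close>.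
\<close>

section \<open>Rayleigh quotients of symmetric matrices\<close>

lemma symmetric_matrix_inner:
  fixes A :: "real^'n^'n"
  assumes "transpose A = A"
  shows "(A *v x) \<bullet> y = x \<bullet> (A *v y)"
proof -
  have "x v* A = A *v x"
    using vector_transpose_matrix[of x A] by (simp only: assms)
  then show ?thesis
    using dot_lmul_matrix[of x A y] by simp
qed

lemma nonneg_quadratic_linear_coeff:
  fixes b c :: real
  assumes "\<And>t. 0 \<le> t * b + t\<^sup>2 * c"
  shows "b = 0"
proof (rule ccontr)
  assume "b \<noteq> 0"
  \<comment> \<open>Any \<open>d\<close> that is positive and exceeds \<open>c\<close> works: at
    \<open>t = - b / d\<close> the quadratic equals \<open>b\<^sup>2 * (c - d) / d\<^sup>2\<close>,
    which is negative.\<close>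
  define d where "d = \<bar>c\<bar> + 1"
  define t where "t = - b / d"
  have d: "d > 0" "c < d"
    by (auto simp: d_def)
  then have "t * b + t\<^sup>2 * c = (b\<^sup>2 / d\<^sup>2) * (c - d)"
    by (simp add: t_def field_simps power2_eq_square)
  also have "\<dots> < 0"
    using \<open>b \<noteq> 0\<close> d by (intro mult_pos_neg divide_pos_pos) auto
  finally show False
    using assms[of t] by simp
qed

text \<open>First variation along the residual \<open>r\<close>: the gap
  \<open>M * (z \<bullet> z) - z \<bullet> (A *v z)\<close> at \<open>z = x + t *\<^sub>R r\<close>
  is nonnegative, vanishes at \<open>t = 0\<close> and has linear coefficient
  \<open>2 * (r \<bullet> r)\<close>, so \<open>r\<close> must be 0.\<close>

lemma Rayleigh_maximizer_eigenvector:
  fixes A :: "real^'n^'n"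
  assumes sym: "transpose A = A"
    and le: "\<And>x. x \<bullet> (A *v x) \<le> M * (x \<bullet> x)"
    and eq: "x \<bullet> (A *v x) = M * (x \<bullet> x)"
  shows "A *v x = M *\<^sub>R x"
proof -
  define r where "r = M *\<^sub>R x - A *v x"
  have "0 \<le> t * (2 * (r \<bullet> r)) + t\<^sup>2 * (M * (r \<bullet> r) - r \<bullet> (A *v r))" for t
  proof -
    have "x \<bullet> (A *v r) = r \<bullet> (A *v x)"
      using symmetric_matrix_inner[OF sym, of x r] by (simp add: inner_commute)
    moreover have "r \<bullet> r = M * (x \<bullet> r) - r \<bullet> (A *v x)"
      by (subst (2) r_def) (simp add: inner_diff_right inner_commute)
    then have "t * (r \<bullet> r) = t * (M * (x \<bullet> r) - r \<bullet> (A *v x))"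
      by simp
    ultimately show ?thesis
      using le[of "x + t *\<^sub>R r"] eq
      by (simp add: matrix_vector_right_distrib matrix_vector_mult_scaleR inner_add_left
          inner_add_right inner_commute algebra_simps power2_eq_square)
  qed
  then have "r \<bullet> r = 0"
    using nonneg_quadratic_linear_coeff by fastforce
  then show ?thesis
    by (simp add: r_def)
qed

text \<open>Eigenvectors for distinct eigenvalues are orthogonal, hence independent, and the
  dimension bounds their number. This makes \<open>Max\<close> an upper bound of the
  spectrum.\<close>

lemma finite_real_eigenvalues:
  fixes A :: "real^'n^'n"
  assumes sym: "transpose A = A"
  shows "finite {k. real_eigenvalue A k}"
proof -
  obtain f where f: "\<And>k. real_eigenvalue A k \<Longrightarrow> real_eigenvector A (f k) k"
    using real_eigenvalue_def by metis
  let ?E = "{k. real_eigenvalue A k}"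
  have orth: "f k \<bullet> f l = 0" if "k \<in> ?E" "l \<in> ?E" "k \<noteq> l" for k l
    using symmetric_matrix_inner[OF sym, of "f k" "f l"] f[of k] f[of l] that
    by (simp add: real_eigenvector_def)
  have nz: "f k \<noteq> 0" if "k \<in> ?E" for k
    using f that by (simp add: real_eigenvector_def)
  have "pairwise orthogonal (f ` ?E)"
    by (auto simp: pairwise_def orthogonal_def) (metis orth mem_Collect_eq)
  moreover have "0 \<notin> f ` ?E"
    using nz by (metis imageE)
  ultimately have "finite (f ` ?E)"
    using pairwise_orthogonal_independent independent_bound by blast
  moreover have "inj_on f ?E"
    by (rule inj_onI) (metis orth nz inner_eq_zero_iff)
  ultimately show ?thesis
    by (rule finite_imageD)
qed

text \<open>By compactness the form attains its maximum \<open>M\<close> on the unit sphere; the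
  maximizer is an eigenvector, so \<open>M\<close> is itself an eigenvalue.\<close>

lemma Rayleigh_le_Max_eigenvalue:
  fixes A :: "real^'n^'n"
  assumes sym: "transpose A = A"
  shows "x \<bullet> (A *v x) \<le> Max {k. real_eigenvalue A k} * (x \<bullet> x)"
proof -
  let ?S = "sphere (0::real^'n) 1"
  have "continuous_on ?S (\<lambda>x. x \<bullet> (A *v x))"
    by (intro continuous_intros matrix_vector_mult_linear_continuous_on)
  moreover have "?S \<noteq> {}"
    by simp
  ultimately obtain y where y: "y \<in> ?S" "\<And>z. z \<in> ?S \<Longrightarrow> z \<bullet> (A *v z) \<le> y \<bullet> (A *v y)"
    using continuous_attains_sup[OF compact_sphere] by blast
  define M where "M = y \<bullet> (A *v y)"
  have le: "z \<bullet> (A *v z) \<le> M * (z \<bullet> z)" for z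
  proof (cases "z = 0")
    case False
    have "(inverse (norm z) *\<^sub>R z) \<bullet> (A *v (inverse (norm z) *\<^sub>R z)) \<le> M"
      unfolding M_def using False by (intro y) simp
    then have "(z \<bullet> (A *v z)) / (norm z)\<^sup>2 \<le> M"
      by (simp add: matrix_vector_mult_scaleR field_simps power2_eq_square)
    then show ?thesis
      using False by (simp add: divide_le_eq power2_norm_eq_inner)
  qed simp
  have "y \<bullet> y = 1"
    using y(1) by (simp add: power2_norm_eq_inner[symmetric])
  then have "A *v y = M *\<^sub>R y"
    using Rayleigh_maximizer_eigenvector[OF sym le, of y] by (simp add: M_def)
  then have "real_eigenvalue A M"
    using \<open>y \<bullet> y = 1\<close> unfolding real_eigenvalue_def real_eigenvector_def
    by (metis inner_zero_left zero_neq_one)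
  then have "M \<le> Max {k. real_eigenvalue A k}"
    by (simp add: finite_real_eigenvalues[OF sym])
  then show ?thesis
    using le[of x] by (meson inner_ge_zero mult_right_mono order_trans)
qed

section \<open>The Sombor matrix\<close>

text \<open>Free of the adjacency test, so that weights can be compared along a map between two
  graphs.\<close>

definition sombor_weight :: "'a pair_pre_digraph \<Rightarrow> 'a \<Rightarrow> 'a \<Rightarrow> real" where
  "sombor_weight G i j = sqrt ((real (vertex_degree G i))\<^sup>2 + (real (vertex_degree G j))\<^sup>2)"

lemma sombor_weight_nonneg: "0 \<le> sombor_weight G i j"
  by (simp add: sombor_weight_def)

lemma sombor_weight_commute: "sombor_weight G i j = sombor_weight G j i"
  by (simp add: sombor_weight_def add.commute)

lemma sombor_weight_mono:
  assumes "vertex_degree G i \<le> vertex_degree H i'" "vertex_degree G j \<le> vertex_degree H j'"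
  shows "sombor_weight G i j \<le> sombor_weight H i' j'"
  unfolding sombor_weight_def using assms
  by (intro real_sqrt_le_mono add_mono power_mono) auto

lemma sombor_weight_pos:
  fixes G :: "'a::finite pair_pre_digraph"
  assumes "(i, j) \<in> parcs G"
  shows "0 < sombor_weight G i j"
proof -
  have "0 < vertex_degree G i"
    using assms by (auto simp: vertex_degree_def neighborhood_def card_gt_0_iff)
  then show ?thesis
    by (simp add: sombor_weight_def add_pos_nonneg)
qed

lemma sombor_matrix_mult:
  "(sombor_matrix G *v x) $ i
    = (\<Sum>j\<in>UNIV. if (i, j) \<in> parcs G then sombor_weight G i j * x $ j else 0)"
  by (auto simp: sombor_matrix_def sombor_weight_def matrix_vector_mult_def intro!: sum.cong)

lemma sombor_quadratic_form:
  "x \<bullet> (sombor_matrix G *v x)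
    = (\<Sum>e\<in>parcs G. sombor_weight G (fst e) (snd e) * (x $ fst e * x $ snd e))"
proof -
  have "x \<bullet> (sombor_matrix G *v x)
      = (\<Sum>i\<in>UNIV. \<Sum>j\<in>UNIV. if (i, j) \<in> parcs G then sombor_weight G i j * (x $ i * x $ j) else 0)"
    unfolding inner_vec_def sombor_matrix_mult sum_distrib_left inner_real_def
    by (intro sum.cong refl) auto
  also have "\<dots> = (\<Sum>e\<in>UNIV. if e \<in> parcs G
      then sombor_weight G (fst e) (snd e) * (x $ fst e * x $ snd e) else 0)"
    unfolding sum.cartesian_product UNIV_Times_UNIV by (intro sum.cong) auto
  also have "\<dots> = (\<Sum>e\<in>parcs G. sombor_weight G (fst e) (snd e) * (x $ fst e * x $ snd e))"
    by (simp add: sum.If_cases)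
  finally show ?thesis .
qed

lemma sombor_matrix_symmetric:
  assumes "\<And>i j. (i, j) \<in> parcs G \<Longrightarrow> (j, i) \<in> parcs G"
  shows "transpose (sombor_matrix G) = sombor_matrix G"
proof -
  have "(i, j) \<in> parcs G \<longleftrightarrow> (j, i) \<in> parcs G" for i j
    by (rule iffI; rule assms)
  then show ?thesis
    by (simp add: transpose_def sombor_matrix_def vec_eq_iff add.commute)
qed

lemma sombor_quadratic_form_le:
  assumes "\<And>i j. (i, j) \<in> parcs G \<Longrightarrow> (j, i) \<in> parcs G"
  shows "x \<bullet> (sombor_matrix G *v x) \<le> sombor_rho1 G * (x \<bullet> x)"
  unfolding sombor_rho1_def
  by (rule Rayleigh_le_Max_eigenvalue[OF sombor_matrix_symmetric[OF assms]])

text \<open>Since the matrix entries are nonnegative, absolute values cannot lower the form, and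
  they keep the norm; the Rayleigh bound then forces equality.\<close>

lemma sombor_abs_eigenvector:
  assumes sym: "\<And>i j. (i, j) \<in> parcs G \<Longrightarrow> (j, i) \<in> parcs G"
    and ev: "sombor_matrix G *v x = sombor_rho1 G *\<^sub>R x"
  shows "sombor_matrix G *v (\<chi> i. \<bar>x $ i\<bar>) = sombor_rho1 G *\<^sub>R (\<chi> i. \<bar>x $ i\<bar>)"
proof -
  let ?y = "\<chi> i. \<bar>x $ i\<bar>"
  have yy: "?y \<bullet> ?y = x \<bullet> x"
    by (simp add: inner_vec_def)
  have "sombor_rho1 G * (x \<bullet> x) = x \<bullet> (sombor_matrix G *v x)"
    by (simp add: ev)
  also have "\<dots> \<le> ?y \<bullet> (sombor_matrix G *v ?y)"
    unfolding sombor_quadratic_form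
    by (intro sum_mono mult_left_mono sombor_weight_nonneg) (simp add: abs_mult[symmetric])
  finally have "?y \<bullet> (sombor_matrix G *v ?y) = sombor_rho1 G * (?y \<bullet> ?y)"
    using sombor_quadratic_form_le[OF sym, of ?y] by (simp add: yy)
  then show ?thesis
    using Rayleigh_maximizer_eigenvector[OF sombor_matrix_symmetric[OF sym]
        sombor_quadratic_form_le[OF sym]] by blast
qed

text \<open>At a zero of \<open>y\<close> the eigenvalue equation is a vanishing sum of nonnegative
  terms, so all neighbors are zeros too; connectedness would spread this to every vertex.\<close>

lemma sombor_nonneg_eigenvector_pos:
  fixes G :: "'a::finite pair_pre_digraph"
  assumes G: "pair_graph G" and V: "pverts G = UNIV"
    and conn: "Digraph_Component.connected (with_proj G)"
    and nonneg: "\<And>i. 0 \<le> y $ i" and "y \<noteq> 0"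
    and ev: "sombor_matrix G *v y = k *\<^sub>R y"
  shows "0 < y $ i"
proof (rule ccontr)
  interpret pair_graph G by fact
  assume "\<not> 0 < y $ i"
  then have "y $ i = 0"
    using nonneg[of i] by simp
  have step: "y $ b = 0" if "y $ a = 0" "(a, b) \<in> parcs G" for a b
  proof -
    have "(\<Sum>j\<in>UNIV. if (a, j) \<in> parcs G then sombor_weight G a j * y $ j else 0) = 0"
      using ev that(1) by (simp add: sombor_matrix_mult[symmetric])
    then have "(if (a, b) \<in> parcs G then sombor_weight G a b * y $ b else 0) = 0"
      by (subst (asm) sum_nonneg_eq_0_iff) (auto simp: sombor_weight_nonneg nonneg)
    then show ?thesis
      using that(2) sombor_weight_pos[OF that(2)] by simp
  qed
  have "strongly_connected (with_proj G)"
    using symmetric_connected_imp_strongly_connected sym_arcs conn by blast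
  then have reach: "i \<rightarrow>\<^sup>*\<^bsub>with_proj G\<^esub> j" for j
    by (simp add: strongly_connected_def V)
  have "y $ j = 0" for j
    using reach[of j] by (induction rule: reachable_induct)
      (use \<open>y $ i = 0\<close> step in \<open>auto simp: arcs_ends_def arc_to_ends_def\<close>)
  then show False
    using \<open>y \<noteq> 0\<close> by (simp add: vec_eq_iff)
qed

section \<open>Shifting the edges\<close>

locale edge_shift = pair_graph G for G :: "'a::finite pair_pre_digraph" +
  fixes u v :: 'a
  assumes uv: "(u, v) \<in> parcs G"
    and degree_u: "vertex_degree G u \<ge> 2"
    and degree_v: "vertex_degree G v \<ge> 2"
    and no_common: "neighborhood G u \<inter> neighborhood G v = {}"
begin

abbreviation "G' \<equiv> shift_edges G u v"

lemma parcs_sym: "(i, j) \<in> parcs G \<Longrightarrow> (j, i) \<in> parcs G"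
  by (rule arcs_symmetric)

lemma parcs_irrefl: "(i, i) \<notin> parcs G"
  using no_loops'[of i i] by blast

lemma u_neq_v: "u \<noteq> v"
  using uv parcs_irrefl by blast

lemma parcs_shift_edges:
  "parcs G' = (parcs G - edges_between v (neighborhood G v - {u}))
     \<union> edges_between u (neighborhood G v - {u})"
  by (simp add: shift_edges_def)

lemma parcs_shift_sym: "(i, j) \<in> parcs G' \<Longrightarrow> (j, i) \<in> parcs G'"
  using parcs_sym[of i j] by (auto simp: parcs_shift_edges edges_between_def)

lemma no_triangle: "(u, w) \<in> parcs G \<Longrightarrow> (v, w) \<notin> parcs G"
  using no_common by (auto simp: neighborhood_def)

lemma uv_in_shift: "(u, v) \<in> parcs G'" "(v, u) \<in> parcs G'"
  using uv parcs_sym[OF uv] parcs_irrefl u_neq_v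
  by (auto simp: parcs_shift_edges edges_between_def neighborhood_def)

lemma degree_shift_u: "vertex_degree G' u = vertex_degree G u + vertex_degree G v - 1"
proof -
  have "neighborhood G' u = neighborhood G u \<union> (neighborhood G v - {u})"
    using u_neq_v parcs_irrefl
    by (auto simp: parcs_shift_edges edges_between_def neighborhood_def)
  moreover have "card \<dots> = card (neighborhood G u) + card (neighborhood G v - {u})"
    using no_common by (intro card_Un_disjoint) auto
  \<comment> \<open>The vertex \<open>u\<close> is itself a neighbor of \<open>v\<close>, whence the
    -1.\<close>
  moreover have "card (neighborhood G v - {u}) = card (neighborhood G v) - 1"
    using parcs_sym[OF uv] by (simp add: neighborhood_def)
  ultimately show ?thesis
    using degree_v by (simp add: vertex_degree_def)
qed

lemma degree_shift_v: "vertex_degree G' v \<ge> 1"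
proof -
  have "u \<in> neighborhood G' v"
    using uv_in_shift by (simp add: neighborhood_def)
  then have "0 < card (neighborhood G' v)"
    by (auto simp: card_gt_0_iff)
  then show ?thesis
    by (simp add: vertex_degree_def)
qed

text \<open>Replacing a neighbor \<open>v\<close> of \<open>w\<close> by \<open>u\<close> loses
  nothing, since without triangles on \<open>uv\<close> no \<open>w\<close> is adjacent to
  both.\<close>

lemma degree_shift_other:
  assumes "w \<noteq> u" "w \<noteq> v"
  shows "vertex_degree G w \<le> vertex_degree G' w"
proof -
  define h where "h z = (if z = v then u else z)" for z
  have u: "(w, u) \<notin> parcs G" if "(w, v) \<in> parcs G"
    using no_triangle parcs_sym that by blast
  have "inj_on h (neighborhood G w)"
    using u by (auto simp: inj_on_def h_def neighborhood_def split: if_splits)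
  moreover have "h ` neighborhood G w \<subseteq> neighborhood G' w"
    using assms parcs_sym
    by (auto simp: h_def neighborhood_def parcs_shift_edges edges_between_def)
  ultimately show ?thesis
    unfolding vertex_degree_def by (intro card_inj_on_le[of h]) auto
qed

definition merge :: "'a \<Rightarrow> 'a" where
  "merge i = (if i = v then u else i)"

text \<open>The arcs of \<open>uv\<close> are exempt because \<open>merge\<close> would collapse
  them to a loop at \<open>u\<close>.\<close>

definition shift_arc :: "'a \<times> 'a \<Rightarrow> 'a \<times> 'a" where
  "shift_arc e = (if e \<in> {(u, v), (v, u)} then e else (merge (fst e), merge (snd e)))"

lemma shift_arc_in:
  assumes e: "e \<in> parcs G"
  shows "shift_arc e \<in> parcs G'"
proof (cases "e \<in> {(u, v), (v, u)}")
  case True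
  then show ?thesis
    using uv_in_shift by (auto simp: shift_arc_def)
next
  case False
  obtain i j where ij: "e = (i, j)"
    by fastforce
  have "(i, j) \<in> parcs G" "(j, i) \<in> parcs G" "i \<noteq> j"
    using e ij parcs_sym parcs_irrefl by auto
  then show ?thesis
    using False ij
    by (auto simp: shift_arc_def merge_def parcs_shift_edges edges_between_def neighborhood_def)
qed

lemma inj_on_shift_arc: "inj_on shift_arc (parcs G)"
proof -
  \<comment> \<open>A left inverse: a moved arc is recognized by not lying in \<open>G\<close>,
    again because there is no triangle on \<open>uv\<close>, and its end \<open>u\<close> is turned
    back into \<open>v\<close>.\<close>
  define unshift where "unshift e = (if e \<in> {(u, v), (v, u)} \<or> e \<in> parcs G then e
    else if fst e = u then (v, snd e) else (fst e, v))" for e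
  have "unshift (shift_arc e) = e" if e: "e \<in> parcs G" for e
  proof -
    obtain i j where ij: "e = (i, j)"
      by fastforce
    consider "e \<in> {(u, v), (v, u)}" | "i = v" "j \<noteq> u" | "j = v" "i \<noteq> u" | "i \<noteq> v" "j \<noteq> v"
      using ij by blast
    then show ?thesis
    proof cases
      case 2
      then have "j \<noteq> v" "(u, j) \<notin> parcs G"
        using e ij parcs_irrefl no_triangle by auto
      then show ?thesis
        using 2 ij u_neq_v by (simp add: unshift_def shift_arc_def merge_def)
    next
      case 3
      then have "i \<noteq> v" "(i, u) \<notin> parcs G"
        using e ij parcs_irrefl no_triangle parcs_sym by blast+
      then show ?thesis
        using 3 ij u_neq_v by (simp add: unshift_def shift_arc_def merge_def)
    qed (use e ij in \<open>auto simp: unshift_def shift_arc_def merge_def\<close>)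
  qed
  then show ?thesis
    by (rule inj_on_inverseI)
qed

text \<open>Both \<open>u\<close> and \<open>v\<close> go to \<open>u\<close>, whose new degree
  \<open>d\<^sub>u + d\<^sub>v - 1\<close> dominates both old ones.\<close>

lemma degree_merge: "vertex_degree G i \<le> vertex_degree G' (merge i)"
  using degree_shift_other[of i] degree_shift_u degree_u degree_v
  by (cases "i = u") (auto simp: merge_def)

lemma sombor_weight_uv: "sombor_weight G u v < sombor_weight G' u v"
proof -
  define a b where "a = real (vertex_degree G u)" and "b = real (vertex_degree G v)"
  have ab: "a \<ge> 2" "b \<ge> 2"
    using degree_u degree_v by (auto simp: a_def b_def)
  have u': "real (vertex_degree G' u) = a + b - 1"
    using degree_shift_u degree_u by (simp add: a_def b_def)
  have "0 < 2 * ((a - 1) * (b - 1))"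
    using ab by simp
  then have "a\<^sup>2 + b\<^sup>2 < (a + b - 1)\<^sup>2 + 1"
    by (simp add: power2_eq_square algebra_simps)
  also have "\<dots> \<le> (a + b - 1)\<^sup>2 + (real (vertex_degree G' v))\<^sup>2"
    using degree_shift_v by simp
  finally show ?thesis
    by (simp add: sombor_weight_def u' flip: a_def b_def)
qed

lemma sombor_quadratic_form_shift:
  assumes pos: "\<And>i. 0 < y $ i"
  obtains z where "z \<bullet> z = y \<bullet> y"
    and "y \<bullet> (sombor_matrix G *v y) < z \<bullet> (sombor_matrix G' *v z)"
proof -
  \<comment> \<open>With the maximum at \<open>u\<close>, \<open>y $ i \<le> z $ merge i\<close>
    holds for \<open>i = u\<close> and \<open>i = v\<close> alike, whichever entry is larger; the
    product over \<open>uv\<close> and the norm are unchanged.\<close>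
  define z where "z = (\<chi> i. if i = u then max (y $ u) (y $ v)
    else if i = v then min (y $ u) (y $ v) else y $ i)"
  have z_pos: "0 < z $ i" for i
    using pos by (simp add: z_def less_max_iff_disj)
  have z_merge: "y $ i \<le> z $ merge i" for i
    by (simp add: z_def merge_def)
  have z_uv: "z $ u * z $ v = y $ u * y $ v"
    using u_neq_v by (simp add: z_def max_def min_def)
  have "z \<bullet> z = y \<bullet> y"
  proof -
    have split: "x \<bullet> x = x $ u * x $ u + x $ v * x $ v + (\<Sum>i\<in>UNIV - {u} - {v}. x $ i * x $ i)"
      for x :: "real^'a"
      using u_neq_v by (simp add: inner_vec_def sum.remove[of UNIV u] sum.remove[of "UNIV - {u}" v])
    show ?thesis
      unfolding split[of z] split[of y] using u_neq_v
      by (auto simp: z_def max_def min_def intro!: sum.cong)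
  qed
  moreover have "y \<bullet> (sombor_matrix G *v y) < z \<bullet> (sombor_matrix G' *v z)"
  proof -
    define f where "f e = sombor_weight G (fst e) (snd e) * (y $ fst e * y $ snd e)" for e
    define g where "g e = sombor_weight G' (fst e) (snd e) * (z $ fst e * z $ snd e)" for e
    have strict: "f (u, v) < g (u, v)"
      using sombor_weight_uv pos by (simp add: f_def g_def z_uv)
    have swap: "f (v, u) = f (u, v)" "g (v, u) = g (u, v)"
      by (simp_all add: f_def g_def mult.commute sombor_weight_commute[of _ v u])
    have le: "f e \<le> g (shift_arc e)" for e
    proof (cases "e \<in> {(u, v), (v, u)}")
      case True
      then show ?thesis
        using strict swap by (auto simp: shift_arc_def)
    next
      case False
      then have "shift_arc e = (merge (fst e), merge (snd e))"
        by (simp add: shift_arc_def)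
      then show ?thesis
        unfolding f_def g_def using pos z_pos
        by (auto intro!: mult_mono sombor_weight_mono degree_merge z_merge sombor_weight_nonneg
            simp: less_imp_le)
    qed
    have "f (u, v) < g (shift_arc (u, v))"
      using strict by (simp add: shift_arc_def)
    then have "sum f (parcs G) < sum (g \<circ> shift_arc) (parcs G)"
      using uv le by (intro sum_strict_mono_ex1) auto
    also have "\<dots> = sum g (shift_arc ` parcs G)"
      by (simp add: sum.reindex[OF inj_on_shift_arc])
    \<comment> \<open>The inclusion of the image suffices, as all terms of \<open>g\<close> are
      nonnegative.\<close>
    also have "\<dots> \<le> sum g (parcs G')"
      using shift_arc_in z_pos
      by (intro sum_mono2) (auto simp: g_def sombor_weight_nonneg less_imp_le)
    finally show ?thesis
      by (simp add: sombor_quadratic_form f_def g_def)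
  qed
  ultimately show ?thesis
    by (rule that)
qed

end

theorem theorem3p3:
  fixes G :: "'a::finite pair_pre_digraph"
    and u v :: 'a
    and X :: "real^'a"
  assumes "pair_graph G"
    and "pverts G = UNIV"
    and "Digraph_Component.connected (with_proj G)"
    and "(u, v) \<in> parcs G"
    and "vertex_degree G u \<ge> 2"
    and "vertex_degree G v \<ge> 2"
    and "neighborhood G u \<inter> neighborhood G v = {}"
    and "real_eigenvector (sombor_matrix G) X (sombor_rho1 G)"
    and "norm X = 1"
    and "X $ u \<ge> X $ v"
  shows "sombor_rho1 (shift_edges G u v) > sombor_rho1 G"
proof -
  interpret edge_shift G u v
    using assms by (simp add: edge_shift_def edge_shift_axioms_def)
  define y where "y = (\<chi> i. \<bar>X $ i\<bar>)"
  have "X \<noteq> 0" and X: "sombor_matrix G *v X = sombor_rho1 G *\<^sub>R X"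
    using assms(8) by (auto simp: real_eigenvector_def)
  have y: "sombor_matrix G *v y = sombor_rho1 G *\<^sub>R y"
    unfolding y_def by (rule sombor_abs_eigenvector[OF parcs_sym X])
  have "y \<noteq> 0"
    using \<open>X \<noteq> 0\<close> by (simp add: y_def vec_eq_iff)
  then have "0 < y $ i" for i
    using sombor_nonneg_eigenvector_pos[OF assms(1-3) _ _ y] by (simp add: y_def)
  then obtain z where z: "z \<bullet> z = y \<bullet> y"
    "y \<bullet> (sombor_matrix G *v y) < z \<bullet> (sombor_matrix G' *v z)"
    using sombor_quadratic_form_shift by blast
  \<comment> \<open>The left side is the form of \<open>G\<close> at its eigenvector
    \<open>y\<close>; the right side bounds the form of \<open>G'\<close> at \<open>z\<close>, which
    has the same norm.\<close>
  then have "sombor_rho1 G * (y \<bullet> y) < sombor_rho1 G' * (y \<bullet> y)"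
    using sombor_quadratic_form_le[OF parcs_shift_sym, of z] by (simp add: y)
  then show ?thesis
    using \<open>y \<noteq> 0\<close> by (simp add: mult_less_cancel_right)
qed

end
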